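(* If $(\lambda_*,z_* )$ is a minimizer of QEPmin, then $\lambda_*$ is the leftmost eigenvalue (the one of smallest real part) of the quadratic eigenvalue problem $(PAP-\lambda I)^2z=\gamma^{-2}b_0b_0^{\top}z$ among those eigenvalues having eigenvectors in $\mathcal N(C^{\top})$.
   Context: Let $A\in\mathbb{R}^{n\times n}$ be symmetric, $C\in\mathbb{R}^{n\times m}$ ($m<n$) full column rank, $b\in\mathbb{R}^m$, $n_0=C(C^{\top}C)^{-1}b$ with $\|n_0\|<1$, $\gamma=\sqrt{1-\|n_0\|^2}$, $P=I-C(C^{\top}C)^{-1}C^{\top}$ (orthogonal projector onto $\mathcal N(C^{\top})$), $b_0=PAn_0$, assumed nonzero. An eigenvalue of the QEP is $\lambda\in\mathbb{C}$ for which a nonzero (complex) vector $z$ satisfies the equation; $z$ is then an eigenvector. QEPmin: minimize $\lambda$ over pairs $(\lambda,z)$ with $\lambda\in\mathbb{R}$, $0\neq z\in\mathcal N(C^{\top})$ and $(PAP-\lambda I)^2z=\gamma^{-2}b_0b_0^{\top}z$. *)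

theory Defs
  imports "HOL-Analysis.Analysis"
begin

text \<open>Setting: A symmetric n x n, C n x m, b in R^m. Dimensions are finite index types.\<close>

definition n0_vec :: "real^'m^'n \<Rightarrow> real^'m \<Rightarrow> real^'n" where
  "n0_vec C b = C *v (matrix_inv (transpose C ** C) *v b)"

definition gamma_of :: "real^'m^'n \<Rightarrow> real^'m \<Rightarrow> real" where
  "gamma_of C b = sqrt (1 - (norm (n0_vec C b))\<^sup>2)"

definition proj_P :: "real^'m^'n \<Rightarrow> real^'n^'n" where
  "proj_P C = mat 1 - C ** matrix_inv (transpose C ** C) ** transpose C"

definition b0_vec :: "real^'n^'n \<Rightarrow> real^'m^'n \<Rightarrow> real^'m \<Rightarrow> real^'n" where
  "b0_vec A C b = proj_P C *v (A *v n0_vec C b)"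

definition outer :: "real^'n \<Rightarrow> real^'n \<Rightarrow> real^'n^'n" where
  "outer u v = (\<chi> i j. u $ i * v $ j)"

text \<open>Complexification of a real matrix.\<close>
definition cmat :: "real^'a^'b \<Rightarrow> complex^'a^'b" where
  "cmat M = (\<chi> i j. complex_of_real (M $ i $ j))"

text \<open>Real QEP equation (PAP - lam I)^2 z = gamma^-2 b0 b0^T z.\<close>
definition QEP_real_eq :: "real^'n^'n \<Rightarrow> real^'m^'n \<Rightarrow> real^'m \<Rightarrow> real \<Rightarrow> real^'n \<Rightarrow> bool" where
  "QEP_real_eq A C b lam z \<longleftrightarrow>
     (let M = proj_P C ** A ** proj_P C - mat lam in
      (M ** M) *v z = (1 / (gamma_of C b)\<^sup>2) *\<^sub>R (outer (b0_vec A C b) (b0_vec A C b) *v z))"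

text \<open>Admissible pairs of QEPmin: lam real, 0 \<noteq> z \<in> N(C^T), QEP holds.\<close>
definition QEPmin_feasible :: "real^'n^'n \<Rightarrow> real^'m^'n \<Rightarrow> real^'m \<Rightarrow> real \<Rightarrow> real^'n \<Rightarrow> bool" where
  "QEPmin_feasible A C b lam z \<longleftrightarrow>
     z \<noteq> 0 \<and> transpose C *v z = 0 \<and> QEP_real_eq A C b lam z"

definition QEPmin_minimizer :: "real^'n^'n \<Rightarrow> real^'m^'n \<Rightarrow> real^'m \<Rightarrow> real \<Rightarrow> real^'n \<Rightarrow> bool" where
  "QEPmin_minimizer A C b lam z \<longleftrightarrow>
     QEPmin_feasible A C b lam z \<and>
     (\<forall>lam' z'. QEPmin_feasible A C b lam' z' \<longrightarrow> lam \<le> lam')"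

text \<open>Complex QEP equation (PAP - mu I)^2 z = gamma^-2 b0 b0^T z, with z complex.\<close>
definition QEP_complex_eq :: "real^'n^'n \<Rightarrow> real^'m^'n \<Rightarrow> real^'m \<Rightarrow> complex \<Rightarrow> complex^'n \<Rightarrow> bool" where
  "QEP_complex_eq A C b mu z \<longleftrightarrow>
     (let M = cmat (proj_P C ** A ** proj_P C) - mat mu in
      (M ** M) *v z = cmat ((1 / (gamma_of C b)\<^sup>2) *\<^sub>R outer (b0_vec A C b) (b0_vec A C b)) *v z)"

text \<open>mu is an eigenvalue of the QEP having an eigenvector in N(C^T).\<close>
definition QEP_eigenvalue_in_N :: "real^'n^'n \<Rightarrow> real^'m^'n \<Rightarrow> real^'m \<Rightarrow> complex \<Rightarrow> bool" where
  "QEP_eigenvalue_in_N A C b mu \<longleftrightarrow>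
     (\<exists>z::complex^'n. z \<noteq> 0 \<and> transpose (cmat C) *v z = 0 \<and> QEP_complex_eq A C b mu z)"

end

theory Submission
  imports Defs
begin

(*
  Put S = PAP, N = N(C^T) and g = b0 / gamma, so that the QEP reads (S - l)^2 w = (g . w) g on N.
  A minimizer a of the trust-region objective y . S y + 2 g . y on the unit sphere of N satisfies
  S a + g = l a with S - l positive semidefinite on N (both by comparing a with its reflections
  in hyperplanes of N).  Then either a kernel vector of S - l or a preimage of a under S - l solves
  the QEP at l, so there is a real QEP eigenvalue below every Rayleigh quotient of S on N.
  For a complex eigenpair (alpha + i beta, x + i y) with beta \<noteq> 0, pairing the equation with
  x - i y gives x . (S - alpha) x + y . (S - alpha) y = 0, so some Rayleigh quotient is at most
  alpha; for beta = 0, x and y are themselves real eigenvectors for alpha.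
*)

(* Otherwise C^T x is rewritten to x v* C and membership in N(C^T) is no longer recognisable. *)
declare transpose_matrix_vector [simp del]

lemma cubic_nonneg_on_pos_imp_const_nonneg:
  fixes a b c d :: real
  assumes "\<And>s. s > 0 \<Longrightarrow> 0 \<le> a + s * b + s\<^sup>2 * c + s ^ 3 * d"
  shows "0 \<le> a"
proof (rule tendsto_lowerbound)
  show "((\<lambda>s. a + s * b + s\<^sup>2 * c + s ^ 3 * d) \<longlongrightarrow> a) (at_right 0)"
    by (auto intro!: tendsto_eq_intros)
  show "\<forall>\<^sub>F s in at_right 0. 0 \<le> a + s * b + s\<^sup>2 * c + s ^ 3 * d"
    using eventually_at_right_less by (rule eventually_mono) (rule assms)
qed simp

definition shift :: "('a \<Rightarrow> 'a) \<Rightarrow> real \<Rightarrow> 'a \<Rightarrow> 'a::real_vector" where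
  "shift f l u = f u - l *\<^sub>R u"

locale projected_qep =
  fixes N :: "'a::euclidean_space set" and f :: "'a \<Rightarrow> 'a" and g :: 'a
  assumes subspace_N: "subspace N"
    and linear_f: "linear f"
    and f_maps_N: "x \<in> N \<Longrightarrow> f x \<in> N"
    and f_symmetric: "x \<in> N \<Longrightarrow> y \<in> N \<Longrightarrow> x \<bullet> f y = y \<bullet> f x"
    and g_in_N: "g \<in> N"
begin

definition qep_solution :: "real \<Rightarrow> 'a \<Rightarrow> bool" where
  "qep_solution l w \<longleftrightarrow> w \<in> N \<and> w \<noteq> 0 \<and> shift f l (shift f l w) = (g \<bullet> w) *\<^sub>R g"

definition trs_objective :: "'a \<Rightarrow> real" where
  "trs_objective y = y \<bullet> f y + 2 * (g \<bullet> y)"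

definition trs_minimizer :: "'a \<Rightarrow> bool" where
  "trs_minimizer a \<longleftrightarrow> a \<in> N \<and> norm a = 1 \<and>
     (\<forall>y\<in>N. norm y = 1 \<longrightarrow> trs_objective a \<le> trs_objective y)"

lemmas N_closed = subspace_add[OF subspace_N] subspace_diff[OF subspace_N] subspace_scale[OF subspace_N]
lemmas f_linear_simps = linear_add[OF linear_f] linear_diff[OF linear_f] linear_scale[OF linear_f]

lemma linear_shift: "linear (shift f l)"
  unfolding shift_def by (intro linear_compose_sub linear_f linear_scaleR)

lemma shift_maps_N: "x \<in> N \<Longrightarrow> shift f l x \<in> N"
  unfolding shift_def by (intro N_closed f_maps_N)

lemma shift_symmetric: "x \<in> N \<Longrightarrow> y \<in> N \<Longrightarrow> x \<bullet> shift f l y = y \<bullet> shift f l x"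
  unfolding shift_def by (simp add: inner_diff_right f_symmetric inner_commute)

lemma trs_minimizer_exists:
  assumes "v \<in> N" "v \<noteq> 0"
  shows "\<exists>a. trs_minimizer a"
proof -
  have "compact (N \<inter> sphere 0 1)"
    using closed_subspace[OF subspace_N] by (simp add: closed_Int_compact)
  moreover have "continuous_on (N \<inter> sphere 0 1) trs_objective"
    unfolding trs_objective_def
    using linear_f by (intro continuous_intros linear_continuous_on) (simp add: linear_conv_bounded_linear)
  moreover have "(1 / norm v) *\<^sub>R v \<in> N \<inter> sphere 0 1"
    using assms by (simp add: N_closed)
  ultimately obtain a where "a \<in> N \<inter> sphere 0 1" "\<forall>y\<in>N \<inter> sphere 0 1. trs_objective a \<le> trs_objective y"
    using continuous_attains_inf by blast
  then show ?thesis
    unfolding trs_minimizer_def by auto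
qed

lemma trs_minimizer_unit:
  assumes "trs_minimizer a"
  shows "a \<in> N" "a \<bullet> a = 1"
  using assms unfolding trs_minimizer_def by (auto simp: norm_eq_1)

lemma trs_minimizer_reflection:
  assumes a: "trs_minimizer a" and x: "x \<in> N"
  shows "(x \<bullet> a) * (x \<bullet> x) * (x \<bullet> (f a + g)) \<le> (x \<bullet> a)\<^sup>2 * (x \<bullet> f x)"
proof (cases "x = 0")
  case False
  note aN = trs_minimizer_unit(1)[OF a] and aa = trs_minimizer_unit(2)[OF a]
  have xx: "x \<bullet> x > 0" using False by simp
  define c where "c = 2 * (x \<bullet> a) / (x \<bullet> x)"
  have xa: "x \<bullet> a = c * (x \<bullet> x) / 2"
    unfolding c_def using xx by simp
  \<comment> \<open>the reflection of a in the hyperplane orthogonal to x stays on the unit sphere of N\<close>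
  define w where "w = a - c *\<^sub>R x"
  have "w \<bullet> w = a \<bullet> a - c * (2 * (x \<bullet> a)) + c * (c * (x \<bullet> x))"
    unfolding w_def by (simp add: inner_diff_left inner_diff_right inner_commute algebra_simps)
  then have "norm w = 1"
    using aa by (simp add: norm_eq_1 xa)
  moreover have "w \<in> N"
    unfolding w_def using aN x by (simp add: N_closed)
  ultimately have "trs_objective a \<le> trs_objective w"
    using a unfolding trs_minimizer_def by blast
  moreover have "trs_objective w = trs_objective a + c\<^sup>2 * (x \<bullet> f x) - 2 * c * (x \<bullet> (f a + g))"
    unfolding trs_objective_def w_def using f_symmetric[OF aN x]
    by (simp add: f_linear_simps inner_diff_left inner_diff_right inner_add_right
        inner_commute power2_eq_square algebra_simps)
  ultimately have "0 \<le> ((x \<bullet> x)\<^sup>2 / 4) * (c\<^sup>2 * (x \<bullet> f x) - 2 * c * (x \<bullet> (f a + g)))"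
    by simp
  also have "\<dots> = (x \<bullet> a)\<^sup>2 * (x \<bullet> f x) - (x \<bullet> a) * (x \<bullet> x) * (x \<bullet> (f a + g))"
    unfolding xa by (simp add: power2_eq_square algebra_simps)
  finally show ?thesis by simp
qed simp

lemma trs_minimizer_stationary:
  assumes a: "trs_minimizer a"
  shows "f a + g = (a \<bullet> (f a + g)) *\<^sub>R a"
proof -
  define \<mu> where "\<mu> = a \<bullet> (f a + g)"
  define e where "e = f a + g - \<mu> *\<^sub>R a"
  note aN = trs_minimizer_unit(1)[OF a] and aa = trs_minimizer_unit(2)[OF a]
  have eN: "e \<in> N"
    unfolding e_def using aN by (simp add: N_closed f_maps_N g_in_N)
  have ea: "e \<bullet> a = 0"
    unfolding e_def \<mu>_def using aa by (simp add: inner_diff_left inner_diff_right inner_commute)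
  have "0 \<le> - (e \<bullet> e)\<^sup>2 + s * (e \<bullet> f e - \<mu> * (e \<bullet> e)) + s\<^sup>2 * (2 * (e \<bullet> f a) - e \<bullet> e)
           + s ^ 3 * (a \<bullet> f a - \<mu>)" if s: "s > 0" for s
  proof -
    \<comment> \<open>the reflection inequality for x = e + s a, divided by s\<close>
    define x where "x = e + s *\<^sub>R a"
    have "x \<in> N"
      unfolding x_def using eN aN by (simp add: N_closed)
    then have refl: "(x \<bullet> a) * (x \<bullet> x) * (x \<bullet> (f a + g)) \<le> (x \<bullet> a)\<^sup>2 * (x \<bullet> f x)"
      by (rule trs_minimizer_reflection[OF a])
    have "f a + g = \<mu> *\<^sub>R a + e"
      unfolding e_def by simp
    then have "x \<bullet> a = s" "x \<bullet> x = e \<bullet> e + s\<^sup>2"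
      "x \<bullet> (f a + g) = \<mu> * s + e \<bullet> e"
      "x \<bullet> f x = e \<bullet> f e + 2 * s * (e \<bullet> f a) + s\<^sup>2 * (a \<bullet> f a)"
      unfolding x_def using ea aa f_symmetric[OF aN eN]
      by (simp_all add: f_linear_simps inner_add_left inner_add_right
          inner_commute power2_eq_square algebra_simps)
    with refl have "s * ((e \<bullet> e + s\<^sup>2) * (\<mu> * s + e \<bullet> e)) \<le>
        s * (s * (e \<bullet> f e + 2 * s * (e \<bullet> f a) + s\<^sup>2 * (a \<bullet> f a)))"
      by (simp only:) (simp add: power2_eq_square algebra_simps)
    then have "(e \<bullet> e + s\<^sup>2) * (\<mu> * s + e \<bullet> e) \<le> s * (e \<bullet> f e + 2 * s * (e \<bullet> f a) + s\<^sup>2 * (a \<bullet> f a))"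
      using s by simp
    then show ?thesis
      by (simp add: power2_eq_square power3_eq_cube algebra_simps)
  qed
  then have "0 \<le> - (e \<bullet> e)\<^sup>2"
    by (rule cubic_nonneg_on_pos_imp_const_nonneg)
  then have "e = 0" by simp
  then show ?thesis
    unfolding e_def \<mu>_def by simp
qed

lemma trs_minimizer_second_order:
  assumes a: "trs_minimizer a" and x: "x \<in> N"
  shows "(a \<bullet> (f a + g)) * (x \<bullet> x) \<le> x \<bullet> f x"
proof -
  define \<mu> where "\<mu> = a \<bullet> (f a + g)"
  note aN = trs_minimizer_unit(1)[OF a] and aa = trs_minimizer_unit(2)[OF a]
  have stat: "f a + g = \<mu> *\<^sub>R a"
    using trs_minimizer_stationary[OF a] unfolding \<mu>_def .
  have transversal: "\<mu> * (y \<bullet> y) \<le> y \<bullet> f y" if y: "y \<in> N" "y \<bullet> a \<noteq> 0" for y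
  proof -
    have "(y \<bullet> a) * (y \<bullet> y) * (\<mu> * (y \<bullet> a)) \<le> (y \<bullet> a)\<^sup>2 * (y \<bullet> f y)"
      using trs_minimizer_reflection[OF a y(1)] unfolding stat by simp
    then have "(y \<bullet> a)\<^sup>2 * (\<mu> * (y \<bullet> y)) \<le> (y \<bullet> a)\<^sup>2 * (y \<bullet> f y)"
      by (simp add: power2_eq_square algebra_simps)
    then show ?thesis
      using y(2) by simp
  qed
  show ?thesis
  proof (cases "x \<bullet> a = 0")
    case True
    \<comment> \<open>tilt x towards a and let the tilt tend to zero\<close>
    have "0 \<le> (x \<bullet> f x - \<mu> * (x \<bullet> x)) + s * (2 * (x \<bullet> f a)) + s\<^sup>2 * (a \<bullet> f a - \<mu>) + s ^ 3 * 0"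
      if "s > 0" for s
    proof -
      have "\<mu> * ((x + s *\<^sub>R a) \<bullet> (x + s *\<^sub>R a)) \<le> (x + s *\<^sub>R a) \<bullet> f (x + s *\<^sub>R a)"
        using that True aa by (intro transversal) (simp_all add: aN x N_closed inner_add_left)
      then show ?thesis
        using True aa f_symmetric[OF aN x]
        by (simp add: f_linear_simps inner_add_left inner_add_right inner_commute
            power2_eq_square algebra_simps)
    qed
    then have "0 \<le> x \<bullet> f x - \<mu> * (x \<bullet> x)"
      by (rule cubic_nonneg_on_pos_imp_const_nonneg)
    then show ?thesis
      by (simp add: \<mu>_def)
  qed (use transversal x in \<open>simp add: \<mu>_def\<close>)
qed

lemma trs_minimizer_qep_solution:
  assumes a: "trs_minimizer a"
  shows "\<exists>w. qep_solution (a \<bullet> (f a + g)) w"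
proof -
  define \<mu> where "\<mu> = a \<bullet> (f a + g)"
  define h where "h = shift f \<mu>"
  note aN = trs_minimizer_unit(1)[OF a] and aa = trs_minimizer_unit(2)[OF a]
  have stat: "f a + g = \<mu> *\<^sub>R a"
    using trs_minimizer_stationary[OF a] unfolding \<mu>_def .
  have ha: "h a = - g"
    unfolding h_def shift_def by (simp add: stat[symmetric])
  have g_inner: "g \<bullet> w = - (a \<bullet> h w)" if "w \<in> N" for w
    using shift_symmetric[OF that aN, of \<mu>] unfolding h_def[symmetric] ha
    by (simp add: inner_commute)
  show ?thesis
  proof (cases "\<exists>e\<in>N. e \<noteq> 0 \<and> h e = 0")
    case True
    then obtain e where "e \<in> N" "e \<noteq> 0" "h e = 0" by blast
    then have "qep_solution \<mu> e"
      using g_inner linear_0[OF linear_shift]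
      unfolding qep_solution_def h_def by simp
    then show ?thesis
      unfolding \<mu>_def by blast
  next
    case False
    \<comment> \<open>h is injective on N, hence onto N, and a preimage of a solves the QEP\<close>
    have "inj_on h N"
    proof (rule inj_onI)
      fix x y assume "x \<in> N" "y \<in> N" "h x = h y"
      then have "x - y \<in> N" "h (x - y) = 0"
        using linear_diff[OF linear_shift] unfolding h_def by (auto simp: N_closed)
      then show "x = y"
        using False by auto
    qed
    then have "inj_on h (span N)"
      by (simp add: span_eq_iff[THEN iffD2, OF subspace_N])
    then have "dim (h ` N) = dim N"
      unfolding h_def by (rule dim_image_eq[OF linear_shift])
    moreover have "h ` N \<subseteq> N"
      using shift_maps_N unfolding h_def by blast
    ultimately have "h ` N = N"
      using subspace_dim_equal[OF linear_subspace_image[OF linear_shift subspace_N] subspace_N]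
      unfolding h_def by simp
    then obtain w where w: "w \<in> N" "h w = a"
      using aN by (metis imageE)
    moreover have "w \<noteq> 0"
      using w aa linear_0[OF linear_shift] unfolding h_def by auto
    moreover have "g \<bullet> w = -1"
      using g_inner[OF w(1)] w(2) aa by simp
    ultimately have "qep_solution \<mu> w"
      unfolding qep_solution_def h_def[symmetric] using ha by simp
    then show ?thesis
      unfolding \<mu>_def by blast
  qed
qed

lemma qep_solution_below_Rayleigh_quotient:
  assumes "v \<in> N" "v \<noteq> 0" "v \<bullet> f v \<le> \<alpha> * (v \<bullet> v)"
  shows "\<exists>l \<le> \<alpha>. \<exists>w. qep_solution l w"
proof -
  obtain a where a: "trs_minimizer a"
    using trs_minimizer_exists[OF assms(1,2)] by blast
  have "(a \<bullet> (f a + g)) * (v \<bullet> v) \<le> \<alpha> * (v \<bullet> v)"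
    using trs_minimizer_second_order[OF a assms(1)] assms(3) by linarith
  then have "a \<bullet> (f a + g) \<le> \<alpha>"
    using assms(2) by simp
  then show ?thesis
    using trs_minimizer_qep_solution[OF a] by blast
qed

lemma qep_solution_below_complex_eigenvalue:
  fixes \<alpha> \<beta> :: real
  defines "h \<equiv> shift f \<alpha>"
  assumes x: "x \<in> N" and y: "y \<in> N" and nonzero: "x \<noteq> 0 \<or> y \<noteq> 0"
    and re: "h (h x + \<beta> *\<^sub>R y) + \<beta> *\<^sub>R (h y - \<beta> *\<^sub>R x) = (g \<bullet> x) *\<^sub>R g"
    and im: "h (h y - \<beta> *\<^sub>R x) - \<beta> *\<^sub>R (h x + \<beta> *\<^sub>R y) = (g \<bullet> y) *\<^sub>R g"
  shows "\<exists>l \<le> \<alpha>. \<exists>w. qep_solution l w"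
proof (cases "\<beta> = 0")
  case True
  then have "h (h x) = (g \<bullet> x) *\<^sub>R g" "h (h y) = (g \<bullet> y) *\<^sub>R g"
    using re im by simp_all
  then show ?thesis
    using x y nonzero unfolding qep_solution_def h_def by blast
next
  case False
  note h_simps = linear_add[OF linear_shift] linear_diff[OF linear_shift] linear_scale[OF linear_shift]
  \<comment> \<open>the imaginary part of the complex equation paired with x - iy\<close>
  have "y \<bullet> (h (h x + \<beta> *\<^sub>R y) + \<beta> *\<^sub>R (h y - \<beta> *\<^sub>R x))
      - x \<bullet> (h (h y - \<beta> *\<^sub>R x) - \<beta> *\<^sub>R (h x + \<beta> *\<^sub>R y))
      = 2 * \<beta> * (x \<bullet> h x + y \<bullet> h y)"
    using shift_symmetric[OF y shift_maps_N[OF x], of \<alpha> \<alpha>]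
      shift_symmetric[OF x shift_maps_N[OF y], of \<alpha> \<alpha>]
    unfolding h_def
    by (simp add: h_simps inner_add_right inner_diff_right inner_commute algebra_simps)
  then have "x \<bullet> h x + y \<bullet> h y = 0"
    unfolding re im using False by (simp add: inner_commute)
  then obtain v where "v \<in> N" "v \<noteq> 0" "v \<bullet> h v \<le> 0"
  proof (cases "x \<noteq> 0 \<and> x \<bullet> h x \<le> 0")
    case False
    with \<open>x \<bullet> h x + y \<bullet> h y = 0\<close> nonzero have "y \<noteq> 0" "y \<bullet> h y \<le> 0"
      by auto
    with y that show thesis by blast
  qed (use x in blast)
  then show ?thesis
    unfolding h_def shift_def
    by (intro qep_solution_below_Rayleigh_quotient) (simp_all add: inner_diff_right)
qed

end

lemma matrix_vector_mult_mat: "mat c *v x = c *s (x :: 'a::semiring_1^'n)"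
  by (simp add: vec_eq_iff matrix_vector_mult_def mat_def if_distrib[where f="\<lambda>a. a * _"] cong: if_cong)

lemma shift_matrix_vector_mult: "shift ((*v) M) l x = (M - mat l) *v x"
  by (simp add: shift_def matrix_vector_mult_diff_rdistrib matrix_vector_mult_mat scalar_mult_eq_scaleR)

lemma inner_transpose_mult: "x \<bullet> (transpose M *v y) = (M *v x) \<bullet> (y :: real^'n)"
  by (metis dot_lmul_matrix inner_commute transpose_matrix_vector)

lemma matrix_inv_right: "invertible M \<Longrightarrow> M ** matrix_inv M = mat 1"
  unfolding invertible_def matrix_inv_def by (rule someI2_ex) auto

lemma invertible_gram_matrix:
  fixes C :: "real^'m^'n"
  assumes "rank C = CARD('m)"
  shows "invertible (transpose C ** C)"
proof -
  have "x = 0" if "(transpose C ** C) *v x = 0" for x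
  proof -
    have "(C *v x) \<bullet> (C *v x) = 0"
      using that by (simp add: inner_transpose_mult[symmetric] matrix_vector_mul_assoc)
    then have "C *v x = C *v 0" by simp
    then show "x = 0"
      using assms full_rank_injective by (metis injD)
  qed
  then show ?thesis
    unfolding invertible_left_inverse matrix_left_invertible_ker by blast
qed

lemma transpose_mult_proj_P:
  fixes C :: "real^'m^'n"
  assumes "rank C = CARD('m)"
  shows "transpose C *v (proj_P C *v w) = 0"
proof -
  have "transpose C *v (proj_P C *v w) = transpose C *v w
      - ((transpose C ** C) ** matrix_inv (transpose C ** C)) *v (transpose C *v w)"
    unfolding proj_P_def
    by (simp only: matrix_vector_mult_diff_rdistrib matrix_vector_mult_diff_distrib
        matrix_vector_mul_assoc[symmetric] matrix_vector_mul_lid)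
  then show ?thesis
    using matrix_inv_right[OF invertible_gram_matrix[OF assms]] by simp
qed

lemma proj_P_left_null_space:
  fixes C :: "real^'m^'n"
  assumes "transpose C *v x = 0"
  shows "proj_P C *v x = x"
  using assms unfolding proj_P_def
  by (simp add: matrix_vector_mult_diff_rdistrib matrix_vector_mul_assoc[symmetric])

lemma inner_proj_P_left_null_space:
  fixes C :: "real^'m^'n"
  assumes "transpose C *v x = 0"
  shows "x \<bullet> (proj_P C *v w) = x \<bullet> w"
proof -
  have "x \<bullet> (C *v y) = 0" for y
    using assms inner_transpose_mult[of y C x] by (simp add: inner_commute)
  then show ?thesis
    unfolding proj_P_def
    by (simp add: matrix_vector_mult_diff_rdistrib matrix_vector_mul_assoc[symmetric] inner_diff_right)
qed

lemma outer_self_mult: "outer u u *v z = (u \<bullet> z) *\<^sub>R u"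
  by (simp add: vec_eq_iff outer_def matrix_vector_mult_def inner_vec_def sum_distrib_left algebra_simps)

definition Re_vec :: "complex^'n \<Rightarrow> real^'n" where
  "Re_vec z = (\<chi> i. Re (z $ i))"

definition Im_vec :: "complex^'n \<Rightarrow> real^'n" where
  "Im_vec z = (\<chi> i. Im (z $ i))"

definition of_real_vec :: "real^'n \<Rightarrow> complex^'n" where
  "of_real_vec x = (\<chi> i. complex_of_real (x $ i))"

lemma complex_vec_eq_iff: "z = w \<longleftrightarrow> Re_vec z = Re_vec w \<and> Im_vec z = Im_vec w"
  by (auto simp: vec_eq_iff Re_vec_def Im_vec_def complex_eq_iff)

lemma Re_vec_of_real_vec [simp]: "Re_vec (of_real_vec x) = x"
  and Im_vec_of_real_vec [simp]: "Im_vec (of_real_vec x) = 0"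
  and Re_vec_0 [simp]: "Re_vec 0 = 0"
  and Im_vec_0 [simp]: "Im_vec 0 = 0"
  by (simp_all add: vec_eq_iff Re_vec_def Im_vec_def of_real_vec_def)

lemma Re_vec_cmat_mult: "Re_vec (cmat M *v z) = M *v Re_vec z"
  and Im_vec_cmat_mult: "Im_vec (cmat M *v z) = M *v Im_vec z"
  by (simp_all add: vec_eq_iff Re_vec_def Im_vec_def cmat_def matrix_vector_mult_def Re_sum Im_sum)

lemma transpose_cmat: "transpose (cmat M) = cmat (transpose M)"
  by (simp add: vec_eq_iff transpose_def cmat_def)

lemma Re_vec_shifted_cmat_mult:
  "Re_vec ((cmat M - mat \<mu>) *v z) = shift ((*v) M) (Re \<mu>) (Re_vec z) + Im \<mu> *\<^sub>R Im_vec z"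
  by (simp add: vec_eq_iff matrix_vector_mult_diff_rdistrib matrix_vector_mult_mat shift_def
      Re_vec_cmat_mult[unfolded Re_vec_def vec_eq_iff, simplified] Re_vec_def Im_vec_def)

lemma Im_vec_shifted_cmat_mult:
  "Im_vec ((cmat M - mat \<mu>) *v z) = shift ((*v) M) (Re \<mu>) (Im_vec z) - Im \<mu> *\<^sub>R Re_vec z"
  by (simp add: vec_eq_iff matrix_vector_mult_diff_rdistrib matrix_vector_mult_mat shift_def
      Im_vec_cmat_mult[unfolded Im_vec_def vec_eq_iff, simplified] Re_vec_def Im_vec_def)

locale qep_setting =
  fixes A :: "real^'n^'n" and C :: "real^'m^'n" and b :: "real^'m"
  assumes symmetric_A: "transpose A = A"
    and full_rank_C: "rank C = CARD('m)"

sublocale qep_setting \<subseteq> projected_qep "{x. transpose C *v x = 0}"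
  "(*v) (proj_P C ** A ** proj_P C)" "(1 / gamma_of C b) *\<^sub>R b0_vec A C b"
proof (rule projected_qep.intro)
  show "linear ((*v) (proj_P C ** A ** proj_P C))"
    by (rule matrix_vector_mul_linear)
  show "subspace {x. transpose C *v x = 0}"
    by (simp add: subspace_def matrix_vector_right_distrib matrix_vector_mult_scaleR)
  show "(1 / gamma_of C b) *\<^sub>R b0_vec A C b \<in> {x. transpose C *v x = 0}"
    unfolding b0_vec_def
    by (simp add: matrix_vector_mult_scaleR transpose_mult_proj_P[OF full_rank_C])
  fix x y :: "real^'n"
  show "(proj_P C ** A ** proj_P C) *v x \<in> {x. transpose C *v x = 0}"
    by (simp add: matrix_vector_mul_assoc[symmetric] transpose_mult_proj_P[OF full_rank_C])
  assume "x \<in> {x. transpose C *v x = 0}" "y \<in> {x. transpose C *v x = 0}"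
  then show "x \<bullet> ((proj_P C ** A ** proj_P C) *v y) = y \<bullet> ((proj_P C ** A ** proj_P C) *v x)"
    using inner_transpose_mult[of x A] symmetric_A
    by (simp add: matrix_vector_mul_assoc[symmetric] inner_proj_P_left_null_space
        proj_P_left_null_space inner_commute)
qed

context qep_setting
begin

lemma QEPmin_feasible_iff: "QEPmin_feasible A C b l w \<longleftrightarrow> qep_solution l w"
  unfolding QEPmin_feasible_def QEP_real_eq_def qep_solution_def Let_def
  by (auto simp: shift_matrix_vector_mult matrix_vector_mul_assoc outer_self_mult
      matrix_vector_mult_scaleR power2_eq_square)

lemma QEP_complex_eq_iff:
  "QEP_complex_eq A C b \<mu> z \<longleftrightarrow>
     (let h = shift ((*v) (proj_P C ** A ** proj_P C)) (Re \<mu>); g = (1 / gamma_of C b) *\<^sub>R b0_vec A C b;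
          x = Re_vec z; y = Im_vec z in
      h (h x + Im \<mu> *\<^sub>R y) + Im \<mu> *\<^sub>R (h y - Im \<mu> *\<^sub>R x) = (g \<bullet> x) *\<^sub>R g \<and>
      h (h y - Im \<mu> *\<^sub>R x) - Im \<mu> *\<^sub>R (h x + Im \<mu> *\<^sub>R y) = (g \<bullet> y) *\<^sub>R g)"
  unfolding QEP_complex_eq_def Let_def complex_vec_eq_iff[of "_ *v z"]
  by (simp add: matrix_vector_mul_assoc[symmetric] Re_vec_shifted_cmat_mult Im_vec_shifted_cmat_mult
      Re_vec_cmat_mult Im_vec_cmat_mult outer_self_mult matrix_vector_mult_scaleR power2_eq_square
      flip: scaleR_matrix_vector_assoc)

lemma left_null_space_cmat_iff:
  "transpose (cmat C) *v z = 0 \<longleftrightarrow> transpose C *v Re_vec z = 0 \<and> transpose C *v Im_vec z = 0"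
  by (simp add: complex_vec_eq_iff[of _ 0] transpose_cmat Re_vec_cmat_mult Im_vec_cmat_mult)

lemma QEPmin_feasible_imp_eigenvalue:
  assumes "QEPmin_feasible A C b l w"
  shows "QEP_eigenvalue_in_N A C b (complex_of_real l)"
proof -
  have w: "qep_solution l w"
    using assms QEPmin_feasible_iff by blast
  have "of_real_vec w \<noteq> 0"
    using w Re_vec_of_real_vec Re_vec_0 unfolding qep_solution_def by metis
  moreover have "transpose (cmat C) *v of_real_vec w = 0"
    using w by (simp add: qep_solution_def left_null_space_cmat_iff)
  moreover have "QEP_complex_eq A C b (complex_of_real l) (of_real_vec w)"
    using w linear_0[OF linear_shift] by (simp add: qep_solution_def QEP_complex_eq_iff)
  ultimately show ?thesis
    unfolding QEP_eigenvalue_in_N_def by blast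
qed

lemma eigenvalue_imp_qep_solution_below:
  assumes "QEP_eigenvalue_in_N A C b \<mu>"
  shows "\<exists>l \<le> Re \<mu>. \<exists>w. qep_solution l w"
proof -
  obtain z where "z \<noteq> 0" "transpose (cmat C) *v z = 0" "QEP_complex_eq A C b \<mu> z"
    using assms unfolding QEP_eigenvalue_in_N_def by blast
  then show ?thesis
    unfolding left_null_space_cmat_iff QEP_complex_eq_iff Let_def complex_vec_eq_iff[of z 0]
    by (intro qep_solution_below_complex_eigenvalue) auto
qed

end

theorem theorem2p10:
  fixes A :: "real^'n^'n" and C :: "real^'m^'n" and b :: "real^'m"
    and lam :: real and z :: "real^'n"
  assumes "transpose A = A"
    and "CARD('m) < CARD('n)"
    and "rank C = CARD('m)"
    and "norm (n0_vec C b) < 1"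
    and "b0_vec A C b \<noteq> 0"
    and "QEPmin_minimizer A C b lam z"
  shows "QEP_eigenvalue_in_N A C b (complex_of_real lam) \<and>
         (\<forall>mu. QEP_eigenvalue_in_N A C b mu \<longrightarrow> lam \<le> Re mu)"
  \<comment> \<open>only the symmetry of A and the rank of C are needed\<close>
proof -
  interpret qep_setting A C b
    using assms(1,3) by unfold_locales
  have feasible: "QEPmin_feasible A C b lam z"
    and least: "\<And>l w. QEPmin_feasible A C b l w \<Longrightarrow> lam \<le> l"
    using assms(6) unfolding QEPmin_minimizer_def by blast+
  have "lam \<le> Re mu" if "QEP_eigenvalue_in_N A C b mu" for mu
    using eigenvalue_imp_qep_solution_below[OF that] least QEPmin_feasible_iff by force
  then show ?thesis
    using QEPmin_feasible_imp_eigenvalue[OF feasible] by blast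
qed

end
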